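(* Let $d\ge1$ and $k\ge0$, $n=dk+1$. The map $T\mapsto\vec a(T)$ from the set of $d$-parking trees on $n$ vertices to the set of $d$-parking functions of length $k$ is a bijection, where $\vec a(T)=(a_1,\dots,a_k)$ with $a_i=\omega(p_i)$, $p_i$ being the common parent of the vertices labeled $i_1,\dots,i_d$ and $\omega$ the depth-first search ordering of $T$ using $[1,n]$.
   Context: A $d$-parking tree is a rooted plane tree on $n=dk+1$ vertices in which the number of children of each vertex is a multiple of $d$, with vertex labels satisfying: (1) the root is labeled $\infty$; (2) every other vertex has a label $i_j$ with $i\in\{1,\dots,k\}$, $j\in\{1,\dots,d\}$; (3) for each fixed $i$, the vertices $i_1,\dots,i_d$ are children of a common parent and are consecutive in the left-to-right order of its children, in this order; (4) each $i\in\{1,\dots,k\}$ labels exactly one such $d$-element set of siblings; (5) if $i_j$ and $i'_{j'}$ are children of the same vertex and $i<i'$, then $i_j$ is to the right of $i'_{j'}$. Depth-first search ordering of a plane tree $T$ on $n$ vertices using $[a,a+n-1]$: the root gets $a$; if the root's children in left-to-right order are $r_1,\dots,r_s$ with subtrees $T_1,\dots,T_s$, then $T_i$ is recursively ordered using the interval $[a+|T_1|+\cdots+|T_{i-1}|+1,\,a+|T_1|+\cdots+|T_i|]$ (preorder numbering). A $d$-parking function of length $k$ is a list $(a_1,\dots,a_k)$ of positive integers whose nondecreasing rearrangement satisfies $a_{(i)}\le d(i-1)+1$ for all $i$. *)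

theory Defs
  imports Main
begin

datatype 'a plane_tree = Node (root_label: 'a) (child_trees: "'a plane_tree list")

text \<open>
  A vertex of a plane tree is represented by its address: \<open>[]\<close> is the root, and \<open>v @ [c]\<close> is the
  child number \<open>c\<close> (from the left, counting from 0) of the vertex \<open>v\<close>.
\<close>

fun subtree_at :: "'a plane_tree \<Rightarrow> nat list \<Rightarrow> 'a plane_tree option" where
  "subtree_at T [] = Some T"
| "subtree_at (Node l ts) (c # v) = (if c < length ts then subtree_at (ts ! c) v else None)"

definition vertices :: "'a plane_tree \<Rightarrow> nat list set" where
  "vertices T = {v. subtree_at T v \<noteq> None}"

definition label_of :: "'a plane_tree \<Rightarrow> nat list \<Rightarrow> 'a" where
  "label_of T v = root_label (the (subtree_at T v))"

definition num_children :: "'a plane_tree \<Rightarrow> nat list \<Rightarrow> nat" where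
  "num_children T v = length (child_trees (the (subtree_at T v)))"

text \<open>
  \<open>dfs_order a T\<close> is the depth-first search ordering of \<open>T\<close> that starts with the number \<open>a\<close>,
  that is, the one using the interval \<open>[a, a + n - 1]\<close> when \<open>T\<close> has \<open>n\<close> vertices.  It is only
  meaningful on \<open>vertices T\<close>.
\<close>

fun dfs_order :: "nat \<Rightarrow> 'a plane_tree \<Rightarrow> nat list \<Rightarrow> nat" where
  "dfs_order a T [] = a"
| "dfs_order a (Node l ts) (c # v) =
     dfs_order (a + (\<Sum>c'<c. card (vertices (ts ! c'))) + 1) (ts ! c) v"

text \<open>\<open>Infty\<close> is the label \<open>\<infinity>\<close> of the root, and \<open>Lab i j\<close> is the label $i_j$.\<close>

datatype parking_label = Infty | Lab nat nat

text \<open>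
  The \<open>d\<close> consecutive children of \<open>v\<close> beginning with child number \<open>m\<close> are labelled
  $i_1, \ldots, i_d$, from left to right.
\<close>

definition is_block :: "nat \<Rightarrow> parking_label plane_tree \<Rightarrow> nat \<Rightarrow> nat list \<Rightarrow> nat \<Rightarrow> bool" where
  "is_block d T i v m \<longleftrightarrow>
     v \<in> vertices T \<and> m + d \<le> num_children T v \<and>
     (\<forall>j\<in>{1..d}. label_of T (v @ [m + (j - 1)]) = Lab i j)"

text \<open>
  The fifth clause says that the vertices $i_1, \ldots, i_d$ are consecutive siblings in this order:
  every vertex labelled $i_j$ is the \<open>j\<close>-th member of a block for \<open>i\<close>.  The sixth says that \<open>i\<close> is
  used for exactly one block.
\<close>

definition parking_tree :: "nat \<Rightarrow> nat \<Rightarrow> parking_label plane_tree \<Rightarrow> bool" where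
  "parking_tree d k T \<longleftrightarrow>
     card (vertices T) = d * k + 1 \<and>
     (\<forall>v\<in>vertices T. d dvd num_children T v) \<and>
     label_of T [] = Infty \<and>
     (\<forall>v\<in>vertices T - {[]}. \<exists>i\<in>{1..k}. \<exists>j\<in>{1..d}. label_of T v = Lab i j) \<and>
     (\<forall>i\<in>{1..k}. \<forall>j\<in>{1..d}. \<forall>u\<in>vertices T. label_of T u = Lab i j \<longrightarrow>
        (\<exists>v m. is_block d T i v m \<and> u = v @ [m + (j - 1)])) \<and>
     (\<forall>i\<in>{1..k}. \<exists>!(v, m). is_block d T i v m) \<and>
     (\<forall>v\<in>vertices T. \<forall>c<num_children T v. \<forall>c'<num_children T v. \<forall>i j i' j'.
        label_of T (v @ [c]) = Lab i j \<and> label_of T (v @ [c']) = Lab i' j' \<and> i < i' \<longrightarrow> c' < c)"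

definition common_parent :: "nat \<Rightarrow> parking_label plane_tree \<Rightarrow> nat \<Rightarrow> nat list" where
  "common_parent d T i =
     (THE v. v \<in> vertices T \<and>
        (\<forall>j\<in>{1..d}. \<exists>c<num_children T v. label_of T (v @ [c]) = Lab i j))"

definition parking_vector :: "nat \<Rightarrow> nat \<Rightarrow> parking_label plane_tree \<Rightarrow> nat list" where
  "parking_vector d k T = map (\<lambda>i. dfs_order 1 T (common_parent d T i)) [1..<k + 1]"

definition parking_function :: "nat \<Rightarrow> nat \<Rightarrow> nat list \<Rightarrow> bool" where
  "parking_function d k as \<longleftrightarrow>
     length as = k \<and> (\<forall>a\<in>set as. 1 \<le> a) \<and>
     (\<forall>i\<in>{1..k}. sort as ! (i - 1) \<le> d * (i - 1) + 1)"

end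

theory Submission
  imports Defs
begin

text \<open>
  A plane tree is determined by the label of its root and its preorder word, the list whose
  \<open>p\<close>-th entry is the list of the labels of the children of the vertex numbered \<open>p\<close>. In a
  \<open>d\<close>-parking tree with vector \<open>as\<close> that entry is forced: it consists of the blocks
  $i_1, \ldots, i_d$ with $a_i = p$, sorted by decreasing \<open>i\<close>. This gives injectivity.
  Conversely, the word of this form built from \<open>as\<close> is the preorder word of a tree iff it
  satisfies the Lukasiewicz condition $d \cdot |\{i : a_i \le q\}| \ge q$ for all $q \le dk$,
  which says precisely that \<open>as\<close> is a \<open>d\<close>-parking function.
\<close>

section \<open>Vertices and child labels\<close>

text \<open>This list is the letter that the vertex \<open>v\<close> contributes to the preorder
  word.\<close>

definition child_labels :: "'a plane_tree \<Rightarrow> nat list \<Rightarrow> 'a list" where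
  "child_labels T v = map root_label (child_trees (the (subtree_at T v)))"

lemma length_child_labels [simp]: "length (child_labels T v) = num_children T v"
  by (simp add: child_labels_def num_children_def)

lemma Nil_in_vertices [simp]: "[] \<in> vertices T"
  by (simp add: vertices_def)

lemma Cons_in_vertices [simp]:
  "c # v \<in> vertices (Node l ts) \<longleftrightarrow> c < length ts \<and> v \<in> vertices (ts ! c)"
  by (simp add: vertices_def)

lemma label_of_Nil [simp]: "label_of T [] = root_label T"
  by (simp add: label_of_def)

lemma child_labels_Nil [simp]: "child_labels (Node l ts) [] = map root_label ts"
  by (simp add: child_labels_def)

lemma child_labels_Cons [simp]:
  "c < length ts \<Longrightarrow> child_labels (Node l ts) (c # v) = child_labels (ts ! c) v"
  by (simp add: child_labels_def)

text \<open>\<open>subtree_at\<close> consumes addresses from the root end, whereas blocks and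
  parents extend an address at its far end; this is the bridge between the two.\<close>

lemma subtree_at_snoc:
  "subtree_at T (v @ [c]) = (case subtree_at T v of None \<Rightarrow> None
     | Some S \<Rightarrow> if c < length (child_trees S) then Some (child_trees S ! c) else None)"
proof (induction v arbitrary: T)
  case Nil
  then show ?case by (cases T) simp
next
  case (Cons b v)
  then show ?case by (cases T) simp
qed

lemma snoc_in_vertices:
  "v @ [c] \<in> vertices T \<longleftrightarrow> v \<in> vertices T \<and> c < num_children T v"
  by (auto simp: vertices_def subtree_at_snoc num_children_def split: option.splits if_splits)

lemma label_of_snoc:
  assumes "v \<in> vertices T" "c < num_children T v"
  shows "label_of T (v @ [c]) = child_labels T v ! c"
  using assms
  by (auto simp: vertices_def label_of_def child_labels_def subtree_at_snoc num_children_def)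

lemma vertices_Node:
  "vertices (Node l ts) = insert [] (\<Union>c<length ts. (#) c ` vertices (ts ! c))"
proof (rule set_eqI)
  fix v
  show "v \<in> vertices (Node l ts) \<longleftrightarrow> v \<in> insert [] (\<Union>c<length ts. (#) c ` vertices (ts ! c))"
    by (cases v) auto
qed

lemma finite_vertices [simp]: "finite (vertices T)"
  by (induction T) (auto simp: vertices_Node)

lemma card_vertices_Node:
  "card (vertices (Node l ts)) = Suc (\<Sum>c<length ts. card (vertices (ts ! c)))"
proof -
  have "card (\<Union>c<length ts. (#) c ` vertices (ts ! c))
      = (\<Sum>c<length ts. card ((#) c ` vertices (ts ! c)))"
    by (rule card_UN_disjoint) auto
  also have "\<dots> = (\<Sum>c<length ts. card (vertices (ts ! c)))"
    by (simp add: card_image)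
  finally show ?thesis
    by (subst vertices_Node, subst card_insert_disjoint) auto
qed

section \<open>Preorder words\<close>

fun preorder :: "'a plane_tree \<Rightarrow> 'a list list" where
  "preorder (Node l ts) = map root_label ts # concat (map preorder ts)"

lemma length_preorder: "length (preorder T) = card (vertices T)"
  by (induction T)
     (auto simp: card_vertices_Node length_concat sum_list_sum_nth atLeast0LessThan
           intro!: sum.cong)

lemma dfs_order_bounds:
  assumes "v \<in> vertices T"
  shows "dfs_order a T v \<in> {a..<a + card (vertices T)}"
  using assms
proof (induction v arbitrary: a T)
  case Nil
  then show ?case by (cases T) (simp add: card_vertices_Node)
next
  case (Cons c v)
  obtain l ts where T: "T = Node l ts" by (cases T)
  let ?f = "\<lambda>c. card (vertices (ts ! c))"
  have c: "c < length ts" and v: "v \<in> vertices (ts ! c)"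
    using Cons.prems T by auto
  have "sum ?f {..<c} + ?f c = sum ?f {..<Suc c}" by simp
  also have "\<dots> \<le> sum ?f {..<length ts}"
    using c by (intro sum_mono2) auto
  finally show ?case
    using Cons.IH[OF v, of "a + sum ?f {..<c} + 1"] T by (auto simp: card_vertices_Node)
qed

text \<open>The subtree of child \<open>c\<close> starts its numbering after the root and its
  \<open>c\<close> left siblings' subtrees, and its preorder word starts after exactly as many
  letters. Hence number and position always differ by the same constant.\<close>

lemma preorder_nth_dfs_order:
  assumes "v \<in> vertices T"
  shows "preorder T ! (dfs_order a T v - a) = child_labels T v"
  using assms
proof (induction v arbitrary: a T)
  case Nil
  then show ?case by (cases T) simp
next
  case (Cons c v)
  obtain l ts where T: "T = Node l ts" by (cases T)
  let ?S = "\<Sum>c'<c. card (vertices (ts ! c'))"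
  have c: "c < length ts" and v: "v \<in> vertices (ts ! c)"
    using Cons.prems T by auto
  \<comment> \<open>Position of the vertex inside the word of its own subtree; writing its number as
    an offset plus \<open>r\<close> removes the truncated subtraction.\<close>
  define r where "r = dfs_order (a + ?S + 1) (ts ! c) v - (a + ?S + 1)"
  have r: "dfs_order (a + ?S + 1) (ts ! c) v = a + ?S + 1 + r" "r < length (preorder (ts ! c))"
    using dfs_order_bounds[OF v, of "a + ?S + 1"] by (auto simp: r_def length_preorder)
  have len: "length (concat (map preorder (take c ts))) = ?S"
    using c by (auto simp: length_concat sum_list_sum_nth length_preorder atLeast0LessThan
        min_def intro!: sum.cong)
  have "concat (map preorder ts) = concat (map preorder (take c ts)) @
      preorder (ts ! c) @ concat (map preorder (drop (Suc c) ts))"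
    by (subst id_take_nth_drop[OF c]) simp
  then have "concat (map preorder ts) ! (?S + r) = preorder (ts ! c) ! r"
    using len r(2) by (simp add: nth_append)
  moreover have "preorder (ts ! c) ! r = child_labels (ts ! c) v"
    using Cons.IH[OF v, of "a + ?S + 1"] by (simp add: r_def)
  ultimately show ?case
    using c r(1) by (simp add: T)
qed

text \<open>The root's number lies below all others, and distinct children occupy disjoint
  intervals, so equal numbers force equal first steps of the two addresses.\<close>

lemma inj_on_dfs_order: "inj_on (dfs_order a T) (vertices T)"
proof (rule inj_onI)
  fix v w
  assume "v \<in> vertices T" "w \<in> vertices T" "dfs_order a T v = dfs_order a T w"
  then show "v = w"
  proof (induction v arbitrary: a T w)
    case Nil
    show ?case
    proof (cases w)
      case (Cons c u)
      obtain l ts where "T = Node l ts" by (cases T)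
      then show ?thesis
        using Nil Cons dfs_order_bounds[of u "ts ! c" "a + (\<Sum>c'<c. card (vertices (ts ! c'))) + 1"]
        by auto
    qed simp
  next
    case (Cons b v)
    obtain l ts where T: "T = Node l ts" by (cases T)
    let ?f = "\<lambda>c. card (vertices (ts ! c))"
    let ?s = "\<lambda>c. a + (\<Sum>c'<c. ?f c') + 1"
    have v: "b < length ts" "v \<in> vertices (ts ! b)" using Cons.prems T by auto
    have bv: "dfs_order (?s b) (ts ! b) v \<in> {?s b..<?s b + ?f b}"
      by (rule dfs_order_bounds[OF v(2)])
    show ?case
    proof (cases w)
      case Nil
      then show ?thesis using Cons.prems(3) bv T by auto
    next
      case w: (Cons c u)
      have u: "c < length ts" "u \<in> vertices (ts ! c)" using Cons.prems T w by auto
      have cu: "dfs_order (?s c) (ts ! c) u \<in> {?s c..<?s c + ?f c}"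
        by (rule dfs_order_bounds[OF u(2)])
      have mono: "?s x + ?f x \<le> ?s y" if "x < y" for x y
      proof -
        have "sum ?f {..<Suc x} \<le> sum ?f {..<y}"
          using that by (intro sum_mono2) auto
        then show ?thesis by simp
      qed
      have eq: "dfs_order (?s b) (ts ! b) v = dfs_order (?s c) (ts ! c) u"
        using Cons.prems(3) T w by simp
      have "b = c"
        using mono[of b c] mono[of c b] bv cu eq by (cases b c rule: linorder_cases) auto
      then show ?thesis
        using Cons.IH[OF v(2), of u "?s b"] u eq w by simp
    qed
  qed
qed

lemma bij_betw_dfs_order:
  "bij_betw (dfs_order 1 T) (vertices T) {1..card (vertices T)}"
proof -
  have sub: "dfs_order 1 T ` vertices T \<subseteq> {1..card (vertices T)}"
    using dfs_order_bounds[of _ T 1] by fastforce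
  \<comment> \<open>Surjectivity by counting: an injective image inside an interval of the same size
    fills it.\<close>
  have "dfs_order 1 T ` vertices T = {1..card (vertices T)}"
    by (rule card_subset_eq[OF _ sub]) (simp_all add: card_image[OF inj_on_dfs_order])
  then show ?thesis
    by (simp add: bij_betw_def inj_on_dfs_order)
qed

text \<open>The induction deletes the root of the first tree and puts its children in front of the
  remaining trees, which removes exactly the first letter of the word. That letter supplies the root
  labels of the new trees; the initial root labels are assumed because the word records only labels
  of children.\<close>

lemma forest_eqI:
  assumes "concat (map preorder ts) = concat (map preorder us)"
    and "map root_label ts = map root_label us"
  shows "ts = us"
  using assms
proof (induction "length (concat (map preorder ts))" arbitrary: ts us rule: less_induct)
  case less
  show ?case
  proof (cases ts)
    case Nil
    then show ?thesis using less.prems by simp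
  next
    case (Cons t ts')
    then obtain l ss where ts: "ts = Node l ss # ts'" by (cases t) auto
    then obtain u us' where "us = u # us'" using less.prems by (cases us) auto
    then obtain ss' where us: "us = Node l ss' # us'" using less.prems ts by (cases u) auto
    have roots: "map root_label ss = map root_label ss'"
      using less.prems ts us by simp
    have "ss @ ts' = ss' @ us'"
      by (rule less.hyps) (use less.prems ts us in simp_all)
    \<comment> \<open>Equal root lists make \<open>ss\<close> and \<open>ss'\<close> equally long,
      so both concatenations split at the same place.\<close>
    then show ?thesis
      using map_eq_imp_length_eq[OF roots] ts us by simp
  qed
qed

lemma tree_eqI:
  assumes "preorder T = preorder U" "root_label T = root_label U"
  shows "T = U"
  using forest_eqI[of "[T]" "[U]"] assms by simp

text \<open>Read a preorder word as a stack machine: each letter pops a vertex and pushes its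
  children. The word belongs to a forest with \<open>r\<close> roots iff the stack, of initial height \<open>r\<close>,
  becomes empty exactly at the end.\<close>

definition lukasiewicz :: "nat \<Rightarrow> 'a list list \<Rightarrow> bool" where
  "lukasiewicz r w \<longleftrightarrow> r + (\<Sum>p<length w. length (w ! p)) = length w \<and>
     (\<forall>q<length w. q < r + (\<Sum>p<q. length (w ! p)))"

lemma lukasiewicz_Nil [simp]: "lukasiewicz r [] \<longleftrightarrow> r = 0"
  by (auto simp: lukasiewicz_def)

text \<open>One step of the stack machine: popping requires a nonempty stack, which is the
  inequality at \<open>q = 0\<close>, and the other inequalities shift by one letter.\<close>

lemma lukasiewicz_Cons:
  "lukasiewicz r (x # w) \<longleftrightarrow> 0 < r \<and> lukasiewicz (length x + (r - 1)) w"
proof -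
  have shift: "(\<Sum>p<Suc q. length ((x # w) ! p)) = length x + (\<Sum>p<q. length (w ! p))" for q
    by (subst sum.lessThan_Suc_shift) simp
  show ?thesis
    unfolding lukasiewicz_def length_Cons All_less_Suc2 shift by auto
qed

lemma lukasiewicz_forest: "lukasiewicz (length ts) (concat (map preorder ts))"
proof (induction "length (concat (map preorder ts))" arbitrary: ts rule: less_induct)
  case less
  show ?case
  proof (cases ts)
    case (Cons t ts')
    then obtain l ss where ts: "ts = Node l ss # ts'" by (cases t) auto
    show ?thesis
      using less.hyps[of "ss @ ts'"] ts by (simp add: lukasiewicz_Cons)
  qed simp
qed

text \<open>Here \<open>ls\<close> holds the labels waiting on the stack. The children
  \<open>x\<close> of the popped vertex go in front; in the forest obtained for the rest, the first
  \<open>length x\<close> trees become the subtrees of that vertex.\<close>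

lemma forest_of_lukasiewicz:
  assumes "lukasiewicz (length ls) w"
  shows "\<exists>ts. map root_label ts = ls \<and> concat (map preorder ts) = w"
  using assms
proof (induction w arbitrary: ls)
  case Nil
  then show ?case by simp
next
  case (Cons x w)
  then obtain l ls' where ls: "ls = l # ls'" by (cases ls) (auto simp: lukasiewicz_Cons)
  then have "lukasiewicz (length (x @ ls')) w"
    using Cons.prems by (simp add: lukasiewicz_Cons)
  from Cons.IH[OF this] obtain us
    where us: "map root_label us = x @ ls'" "concat (map preorder us) = w"
    by blast
  define ss ts where "ss = take (length x) us" and "ts = drop (length x) us"
  have "us = ss @ ts" by (simp add: ss_def ts_def)
  moreover have "map root_label ss = x" "map root_label ts = ls'"
    using us(1) by (simp_all add: ss_def ts_def take_map[symmetric] drop_map[symmetric])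
  ultimately show ?case
    using us(2) ls by (intro exI[of _ "Node l ss # ts"]) auto
qed

section \<open>Sorted blocks\<close>

text \<open>The left-to-right order forced on siblings: larger \<open>i\<close> first by condition
  (5), then increasing \<open>j\<close> inside a block by condition (3).\<close>

fun label_before :: "parking_label \<Rightarrow> parking_label \<Rightarrow> bool" where
  "label_before (Lab i j) (Lab i' j') \<longleftrightarrow> i' < i \<or> i = i' \<and> j < j'"
| "label_before _ _ \<longleftrightarrow> False"

lemma label_before_asym: "label_before x y \<Longrightarrow> \<not> label_before y x"
  by (cases x; cases y) auto

text \<open>If the heads differed, each would occur in the tail of the other list and so precede the
  other head, against asymmetry. Asymmetry also rules out repetitions, so the tails again have equal
  sets. Equality of sibling lists thereby reduces to equality of label sets.\<close>

lemma sorted_wrt_asym_unique: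
  assumes "sorted_wrt R xs" "sorted_wrt R ys" "set xs = set ys"
    and asym: "\<And>x y. R x y \<Longrightarrow> \<not> R y x"
  shows "xs = ys"
  using assms(1-3)
proof (induction xs arbitrary: ys)
  case Nil
  then show ?case by simp
next
  case (Cons x xs)
  then obtain y ys' where ys: "ys = y # ys'" by (cases ys) auto
  have "x = y"
  proof (rule ccontr)
    assume "x \<noteq> y"
    then have "x \<in> set ys'" "y \<in> set xs"
      using Cons.prems(3) unfolding ys by auto
    then have "R x y" "R y x"
      using Cons.prems(1,2) unfolding ys by auto
    then show False using asym by blast
  qed
  moreover have "x \<notin> set xs" "y \<notin> set ys'"
    using Cons.prems asym[of x x] asym[of y y] unfolding ys by auto
  ultimately have "set xs = set ys'"
    using Cons.prems(3) unfolding ys by auto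
  then show ?case
    using Cons \<open>x = y\<close> unfolding ys by auto
qed

definition blocks :: "nat \<Rightarrow> nat list \<Rightarrow> parking_label list" where
  "blocks d is = concat (map (\<lambda>i. map (Lab i) [1..<d + 1]) is)"

lemma blocks_Nil [simp]: "blocks d [] = []"
  and blocks_Cons [simp]: "blocks d (i # is) = map (Lab i) [1..<d + 1] @ blocks d is"
  by (simp_all add: blocks_def)

lemma length_blocks [simp]: "length (blocks d is) = d * length is"
  by (induction "is") auto

lemma set_blocks: "set (blocks d is) = {Lab i j | i j. i \<in> set is \<and> j \<in> {1..d}}"
  by (induction "is") auto

lemma blocks_nth:
  assumes "r < length is" "s < d"
  shows "blocks d is ! (d * r + s) = Lab (is ! r) (s + 1)"
  using assms
proof (induction "is" arbitrary: r)
  case (Cons i "is")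
  then show ?case
    by (cases r) (auto simp: nth_append simp del: upt_Suc)
qed simp

lemma sorted_blocks:
  assumes "sorted_wrt (>) is"
  shows "sorted_wrt label_before (blocks d is)"
  using assms
proof (induction "is")
  case (Cons i "is")
  have "sorted_wrt label_before (map (Lab i) [1..<d + 1])"
    by (simp add: sorted_wrt_map del: upt_Suc)
  then show ?case
    using Cons by (auto simp: sorted_wrt_append set_blocks simp del: upt_Suc)
qed simp

text \<open>The sibling list forced on the children of the vertex numbered \<open>p\<close>.
  \<open>rev\<close> is there because larger \<open>i\<close> stand further left.\<close>

definition child_word :: "nat \<Rightarrow> nat \<Rightarrow> nat list \<Rightarrow> nat \<Rightarrow> parking_label list" where
  "child_word d k as p = blocks d (rev (filter (\<lambda>i. as ! (i - 1) = p) [1..<k + 1]))"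

lemma set_child_word:
  "set (child_word d k as p) = {Lab i j | i j. i \<in> {1..k} \<and> as ! (i - 1) = p \<and> j \<in> {1..d}}"
  by (auto simp: child_word_def set_blocks)

lemma sorted_child_word: "sorted_wrt label_before (child_word d k as p)"
  unfolding child_word_def
  by (rule sorted_blocks) (simp add: sorted_wrt_rev sorted_wrt_filter del: upt_Suc)

lemma length_child_word:
  assumes "length as = k"
  shows "length (child_word d k as p) = d * length (filter (\<lambda>a. a = p) as)"
proof -
  \<comment> \<open>Listing \<open>as\<close> by its indices turns counting indices \<open>i\<close>
    with entry \<open>p\<close> into counting occurrences of \<open>p\<close>.\<close>
  have "as = map (\<lambda>i. as ! (i - 1)) [1..<k + 1]"
    using assms by (intro nth_equalityI) (auto simp del: upt_Suc)
  then have "length (filter (\<lambda>a. a = p) as) =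
      length (filter (\<lambda>a. a = p) (map (\<lambda>i. as ! (i - 1)) [1..<k + 1]))"
    by (rule arg_cong)
  also have "\<dots> = length (filter (\<lambda>i. as ! (i - 1) = p) [1..<k + 1])"
    by (simp only: filter_map length_map comp_def)
  finally show ?thesis
    unfolding child_word_def length_blocks length_rev by (rule arg_cong[OF sym])
qed

section \<open>Parking trees and their preorder words\<close>

lemma parking_tree_child_label:
  assumes T: "parking_tree d k T" and v: "v \<in> vertices T" and c: "c < num_children T v"
  obtains i j m where "child_labels T v ! c = Lab i j" "i \<in> {1..k}" "j \<in> {1..d}"
    "is_block d T i v m" "c = m + (j - 1)"
proof -
  have "v @ [c] \<in> vertices T - {[]}"
    using v c by (simp add: snoc_in_vertices)
  with T obtain i j where ij: "i \<in> {1..k}" "j \<in> {1..d}" "label_of T (v @ [c]) = Lab i j"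
    unfolding parking_tree_def by blast
  with T \<open>v @ [c] \<in> vertices T - {[]}\<close> obtain w m
    where "is_block d T i w m" "v @ [c] = w @ [m + (j - 1)]"
    unfolding parking_tree_def by blast
  moreover from this have "w = v" "c = m + (j - 1)" by simp_all
  moreover have "child_labels T v ! c = Lab i j"
    using ij(3) label_of_snoc[OF v c] by simp
  ultimately show thesis
    using that ij(1,2) by blast
qed

lemma is_block_unique:
  assumes "parking_tree d k T" "i \<in> {1..k}" "is_block d T i v m" "is_block d T i v' m'"
  shows "v = v' \<and> m = m'"
  using assms unfolding parking_tree_def by blast

text \<open>A vertex with a child labelled \<open>Lab i 1\<close> carries a block for
  \<open>i\<close>, and there is only one such block.\<close>

lemma common_parent_eq:
  assumes d: "1 \<le> d" and T: "parking_tree d k T" and i: "i \<in> {1..k}" and b: "is_block d T i v m"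
  shows "common_parent d T i = v"
  unfolding common_parent_def
proof (rule the_equality)
  show "v \<in> vertices T \<and> (\<forall>j\<in>{1..d}. \<exists>c<num_children T v. label_of T (v @ [c]) = Lab i j)"
  proof (intro conjI ballI)
    show "v \<in> vertices T" using b by (simp add: is_block_def)
    fix j assume "j \<in> {1..d}"
    then show "\<exists>c<num_children T v. label_of T (v @ [c]) = Lab i j"
      using b by (intro exI[of _ "m + (j - 1)"]) (auto simp: is_block_def)
  qed
next
  fix w
  assume "w \<in> vertices T \<and> (\<forall>j\<in>{1..d}. \<exists>c<num_children T w. label_of T (w @ [c]) = Lab i j)"
  moreover have "1 \<in> {1..d}" using d by simp
  ultimately obtain c
    where w: "w \<in> vertices T" "c < num_children T w" "label_of T (w @ [c]) = Lab i 1"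
    by blast
  from parking_tree_child_label[OF T w(1,2)] obtain m' where "is_block d T i w m'"
    by (metis label_of_snoc parking_label.inject w)
  then show "w = v"
    using is_block_unique[OF T i] b by blast
qed

lemma length_parking_vector [simp]: "length (parking_vector d k T) = k"
  by (simp add: parking_vector_def)

lemma parking_vector_nth:
  assumes "i \<in> {1..k}"
  shows "parking_vector d k T ! (i - 1) = dfs_order 1 T (common_parent d T i)"
  using assms by (auto simp: parking_vector_def simp del: upt_Suc)

text \<open>The core of injectivity: the vector determines every sibling list. Both sides are sorted
  by \<open>label_before\<close>, so only their sets of labels have to be compared.\<close>

lemma parking_tree_child_labels:
  assumes d: "1 \<le> d" and T: "parking_tree d k T" and v: "v \<in> vertices T"
  shows "child_labels T v = child_word d k (parking_vector d k T) (dfs_order 1 T v)"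
proof (rule sorted_wrt_asym_unique[OF _ sorted_child_word])
  show "sorted_wrt label_before (child_labels T v)"
    unfolding sorted_wrt_iff_nth_less length_child_labels
  proof (intro allI impI)
    fix c c' assume c: "c < c'" "c' < num_children T v"
    from c obtain i j m where 1: "child_labels T v ! c = Lab i j" "i \<in> {1..k}" "j \<in> {1..d}"
        "is_block d T i v m" "c = m + (j - 1)"
      using parking_tree_child_label[OF T v, of c] by (metis order.strict_trans)
    from c obtain i' j' m' where 2: "child_labels T v ! c' = Lab i' j'" "j' \<in> {1..d}"
        "is_block d T i' v m'" "c' = m' + (j' - 1)"
      using parking_tree_child_label[OF T v, of c'] by metis
    have "\<not> i < i'"
    proof
      assume "i < i'"
      moreover have "c < num_children T v" using c by simp
      moreover have "label_of T (v @ [c]) = Lab i j" "label_of T (v @ [c']) = Lab i' j'"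
        using 1(1) 2(1) c by (simp_all add: label_of_snoc[OF v])
      ultimately have "c' < c"
        using T v c(2) unfolding parking_tree_def by blast
      with c show False by simp
    qed
    \<comment> \<open>Both children lie in the unique block of \<open>i\<close>, where the position
      determines \<open>j\<close>.\<close>
    moreover have "j < j'" if "i = i'"
    proof -
      have "m = m'"
        using is_block_unique[OF T 1(2,4)] 2(3) that by blast
      then show ?thesis
        using 1(5) 2(4) c(1) by linarith
    qed
    ultimately show "label_before (child_labels T v ! c) (child_labels T v ! c')"
      using 1(1) 2(1) by auto
  qed
  show "set (child_labels T v) = set (child_word d k (parking_vector d k T) (dfs_order 1 T v))"
  proof (intro set_eqI iffI)
    fix x assume "x \<in> set (child_labels T v)"
    then obtain c where "c < num_children T v" "x = child_labels T v ! c"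
      by (metis in_set_conv_nth length_child_labels)
    then obtain i j m where "x = Lab i j" "i \<in> {1..k}" "j \<in> {1..d}" "is_block d T i v m"
      using parking_tree_child_label[OF T v, of c] by metis
    then show "x \<in> set (child_word d k (parking_vector d k T) (dfs_order 1 T v))"
      using common_parent_eq[OF d T, of i v m] parking_vector_nth[of i k d T]
      by (simp add: set_child_word)
  next
    fix x assume "x \<in> set (child_word d k (parking_vector d k T) (dfs_order 1 T v))"
    then obtain i j where x: "x = Lab i j" "i \<in> {1..k}" "j \<in> {1..d}"
      "parking_vector d k T ! (i - 1) = dfs_order 1 T v"
      unfolding set_child_word by blast
    obtain w m where b: "is_block d T i w m"
      using T x(2) unfolding parking_tree_def by blast
    have "w \<in> vertices T" using b by (simp add: is_block_def)
    \<comment> \<open>The parent \<open>w\<close> of the block has the same depth-first number as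
      \<open>v\<close>.\<close>
    then have "w = v"
      using x(4) v common_parent_eq[OF d T x(2) b] parking_vector_nth[OF x(2)]
        inj_onD[OF inj_on_dfs_order] by metis
    then have "m + (j - 1) < num_children T v" "label_of T (v @ [m + (j - 1)]) = x"
      using b x by (auto simp: is_block_def)
    then show "x \<in> set (child_labels T v)"
      using label_of_snoc[OF v] by (metis length_child_labels nth_mem)
  qed
qed (rule label_before_asym)

lemma preorder_nth_eq_child_labels:
  assumes "p < card (vertices T)"
  obtains v where "v \<in> vertices T" "dfs_order 1 T v = p + 1" "preorder T ! p = child_labels T v"
proof -
  have "p + 1 \<in> dfs_order 1 T ` vertices T"
    using bij_betw_dfs_order[of T] assms by (simp add: bij_betw_def)
  then obtain v where "v \<in> vertices T" "dfs_order 1 T v = p + 1" by auto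
  then show thesis
    using that preorder_nth_dfs_order[of v T 1] by simp
qed

text \<open>List positions start at 0 and depth-first numbers at 1, hence
  \<open>p + 1\<close>.\<close>

definition parking_word :: "nat \<Rightarrow> nat \<Rightarrow> nat list \<Rightarrow> parking_label list list" where
  "parking_word d k as = map (\<lambda>p. child_word d k as (p + 1)) [0..<d * k + 1]"

lemma length_parking_word [simp]: "length (parking_word d k as) = d * k + 1"
  by (simp add: parking_word_def)

lemma parking_word_nth:
  "p < d * k + 1 \<Longrightarrow> parking_word d k as ! p = child_word d k as (p + 1)"
  by (simp add: parking_word_def del: upt_Suc)

lemma preorder_parking_tree:
  assumes "1 \<le> d" "parking_tree d k T"
  shows "preorder T = parking_word d k (parking_vector d k T)"
proof (rule nth_equalityI)
  have n: "card (vertices T) = d * k + 1"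
    using assms(2) by (simp add: parking_tree_def)
  then show "length (preorder T) = length (parking_word d k (parking_vector d k T))"
    by (simp add: length_preorder)
  fix p assume "p < length (preorder T)"
  then have p: "p < card (vertices T)" by (simp add: length_preorder)
  then obtain v where "v \<in> vertices T" "dfs_order 1 T v = p + 1" "preorder T ! p = child_labels T v"
    by (rule preorder_nth_eq_child_labels)
  then show "preorder T ! p = parking_word d k (parking_vector d k T) ! p"
    using parking_tree_child_labels[OF assms] p n by (simp add: parking_word_nth)
qed

text \<open>Converse direction: each sibling list of \<open>T\<close> is a
  \<open>child_word\<close>, so the clauses on labels and blocks are read off from
  \<open>as\<close>. The range of \<open>as\<close> ensures that every entry is the number of an
  actual vertex, so that every block occurs.\<close>

lemma
  assumes d: "1 \<le> d" and root: "root_label T = Infty" and pre: "preorder T = parking_word d k as"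
    and len: "length as = k" and ran: "set as \<subseteq> {1..d * k + 1}"
  shows parking_tree_of_word: "parking_tree d k T"
    and parking_vector_of_word: "parking_vector d k T = as"
proof -
  have n: "card (vertices T) = d * k + 1"
    using pre length_preorder[of T] by simp
  have labels: "child_labels T v = child_word d k as (dfs_order 1 T v)" if "v \<in> vertices T" for v
  proof -
    have "dfs_order 1 T v \<in> {1..d * k + 1}"
      using dfs_order_bounds[OF that, of 1] n by auto
    then show ?thesis
      using preorder_nth_dfs_order[OF that, of 1] pre parking_word_nth[of "dfs_order 1 T v - 1"]
      by fastforce
  qed
  have sorted: "sorted_wrt label_before (child_labels T v)" if "v \<in> vertices T" for v
    by (simp add: labels[OF that] sorted_child_word)
  have before: "label_before (child_labels T v ! c) (child_labels T v ! c')"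
    if "v \<in> vertices T" "c < c'" "c' < num_children T v" for v c c'
    using sorted_wrt_nth_less[OF sorted[OF that(1)] that(2)] that(3) by simp
  have inj: "c = c'" if "v \<in> vertices T" "c < num_children T v" "c' < num_children T v"
    "child_labels T v ! c = child_labels T v ! c'" for v c c'
    using before[of v c c'] before[of v c' c] that label_before_asym
    by (metis linorder_neqE_nat)
  have vec: "as ! (i - 1) = dfs_order 1 T v" "i \<in> {1..k}" "j \<in> {1..d}"
    if "v \<in> vertices T" "c < num_children T v" "child_labels T v ! c = Lab i j" for v c i j
  proof -
    have "Lab i j \<in> set (child_labels T v)"
      using that by (metis length_child_labels nth_mem)
    then show "as ! (i - 1) = dfs_order 1 T v" "i \<in> {1..k}" "j \<in> {1..d}"
      using labels[OF that(1)] by (auto simp: set_child_word)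
  qed
  have dvd: "d dvd num_children T v" if "v \<in> vertices T" for v
    using labels[OF that] length_child_labels[of T v] by (metis child_word_def dvd_triv_left length_blocks)
  have block: "\<exists>m. is_block d T i v m \<and> c = m + (j - 1)"
    if v: "v \<in> vertices T" and c: "c < num_children T v" and l: "child_labels T v ! c = Lab i j"
    for v c i j
  proof -
    obtain "is" where L: "child_labels T v = blocks d is"
      using labels[OF v] by (auto simp: child_word_def)
    then have num: "num_children T v = d * length is"
      by (metis length_blocks length_child_labels)
    \<comment> \<open>All blocks have length \<open>d\<close>, so child \<open>c\<close> is member
      \<open>s\<close> (from 0) of block \<open>r\<close>, which begins at child
      \<open>d * r\<close>.\<close>
    define r s where "r = c div d" and "s = c mod d"
    have rs: "c = d * r + s" "s < d" "r < length is"
      using d c num by (auto simp: r_def s_def less_mult_imp_div_less mult.commute)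
    have ij: "i = is ! r" "j = s + 1"
      using l blocks_nth[OF rs(3,2)] L rs(1) by auto
    have "d * Suc r \<le> d * length is"
      using rs(3) by (intro mult_le_mono) auto
    then have "d * r + d \<le> num_children T v"
      using num by simp
    moreover have "label_of T (v @ [d * r + (j' - 1)]) = Lab i j'" if "j' \<in> {1..d}" for j'
    proof -
      have s': "j' - 1 < d" using that by auto
      then have "label_of T (v @ [d * r + (j' - 1)]) = child_labels T v ! (d * r + (j' - 1))"
        using label_of_snoc[OF v] \<open>d * r + d \<le> num_children T v\<close> by simp
      then show ?thesis
        using blocks_nth[OF rs(3) s'] L ij that by simp
    qed
    ultimately have "is_block d T i v (d * r)"
      using v by (simp add: is_block_def)
    then show ?thesis
      using rs ij by auto
  qed
  have vertex_cases: "\<exists>v c. u = v @ [c] \<and> v \<in> vertices T \<and> c < num_children T v \<and>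
      label_of T u = child_labels T v ! c" if "u \<in> vertices T" "u \<noteq> []" for u
    using that label_of_snoc by (metis rev_exhaust snoc_in_vertices)
  have first: "m < num_children T v" "child_labels T v ! m = Lab i 1" "v \<in> vertices T"
    if "is_block d T i v m" for i v m
  proof -
    show v: "v \<in> vertices T" and m: "m < num_children T v"
      using that d by (auto simp: is_block_def)
    have "\<forall>j\<in>{1..d}. label_of T (v @ [m + (j - 1)]) = Lab i j"
      using that by (simp add: is_block_def)
    from bspec[OF this, of 1] show "child_labels T v ! m = Lab i 1"
      using d label_of_snoc[OF v m] by simp
  qed
  have ex1: "\<exists>!(v, m). is_block d T i v m" if i: "i \<in> {1..k}" for i
  proof -
    have "as ! (i - 1) \<in> set as"
      using i len by (intro nth_mem) auto
    then have "as ! (i - 1) \<in> dfs_order 1 T ` vertices T"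
      using ran n bij_betw_dfs_order[of T] by (auto simp: bij_betw_def)
    then obtain v where v: "v \<in> vertices T" "as ! (i - 1) = dfs_order 1 T v" by auto
    then have "Lab i 1 \<in> set (child_labels T v)"
      using i d by (auto simp: labels set_child_word)
    then obtain c where "c < num_children T v" "child_labels T v ! c = Lab i 1"
      by (metis in_set_conv_nth length_child_labels)
    then obtain m where b: "is_block d T i v m"
      using block v(1) by blast
    \<comment> \<open>Every block for \<open>i\<close> hangs below the vertex numbered
      \<open>as ! (i - 1)\<close> and starts at its child labelled \<open>Lab i 1\<close>; sibling
      labels are distinct.\<close>
    have "w = v \<and> m' = m" if b': "is_block d T i w m'" for w m'
    proof -
      have "dfs_order 1 T w = dfs_order 1 T v"
        using vec(1)[of w m' i 1] first[OF b'] v(2) by simp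
      then have "w = v"
        using v(1) first(3)[OF b'] inj_onD[OF inj_on_dfs_order] by metis
      then show ?thesis
        using inj[of v m m'] first[OF b] first[OF b'] by auto
    qed
    with b show ?thesis by auto
  qed
  show tree: "parking_tree d k T"
    unfolding parking_tree_def
  proof (intro conjI ballI allI impI)
    fix u assume "u \<in> vertices T - {[]}"
    then obtain v c where u: "u = v @ [c]" "v \<in> vertices T" "c < num_children T v"
      "label_of T u = child_labels T v ! c"
      using vertex_cases by blast
    have "child_labels T v ! c \<in> set (child_labels T v)"
      using u(3) by simp
    then show "\<exists>i\<in>{1..k}. \<exists>j\<in>{1..d}. label_of T u = Lab i j"
      using labels[OF u(2)] u(4) by (auto simp: set_child_word)
  next
    fix i j u assume "u \<in> vertices T" "label_of T u = Lab i j"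
    moreover from this have "u \<noteq> []" using root by auto
    ultimately show "\<exists>v m. is_block d T i v m \<and> u = v @ [m + (j - 1)]"
      using vertex_cases block by metis
  next
    fix v c c' i j i' j'
    assume *: "v \<in> vertices T" "c < num_children T v" "c' < num_children T v"
      "label_of T (v @ [c]) = Lab i j \<and> label_of T (v @ [c']) = Lab i' j' \<and> i < i'"
    then have "c \<noteq> c'" by auto
    moreover have "\<not> c < c'"
      using before[of v c c'] * label_of_snoc[of v T] by auto
    ultimately show "c' < c" by simp
  qed (use n dvd root ex1 in auto)
  show "parking_vector d k T = as"
  proof (rule nth_equalityI)
    show "length (parking_vector d k T) = length as"
      using len by simp
    fix p assume "p < length (parking_vector d k T)"
    then have i: "p + 1 \<in> {1..k}" by simp
    then obtain v m where b: "is_block d T (p + 1) v m" using ex1 by blast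
    have "as ! p = dfs_order 1 T v"
      using vec(1)[of v m "p + 1" 1] first[OF b] by simp
    then show "parking_vector d k T ! p = as ! p"
      using parking_vector_nth[OF i, of d T] common_parent_eq[OF d tree i b] by simp
  qed
qed

section \<open>Parking functions and preorder words\<close>

text \<open>In a sorted list the entries at most \<open>q\<close> form an initial segment. This
  turns the bounds on the rearrangement into counts that ignore order.\<close>

lemma sorted_nth_le_iff:
  fixes xs :: "'a::linorder list"
  assumes "sorted xs" "j < length xs"
  shows "xs ! j \<le> q \<longleftrightarrow> j < length (filter (\<lambda>x. x \<le> q) xs)"
  using assms
proof (induction xs arbitrary: j)
  case (Cons x xs)
  show ?case
  proof (cases j)
    case 0
    have "filter (\<lambda>x. x \<le> q) xs = []" if "\<not> x \<le> q"
      using that Cons.prems by (auto simp: filter_empty_conv)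
    then show ?thesis using 0 by auto
  next
    case (Suc j')
    have "x \<le> xs ! j'" using Cons.prems Suc by auto
    moreover have "filter (\<lambda>x. x \<le> q) xs = []" if "\<not> x \<le> q"
      using that Cons.prems by (auto simp: filter_empty_conv)
    ultimately show ?thesis using Cons Suc by auto
  qed
qed simp

lemma sort_nth_le_iff:
  fixes xs :: "nat list"
  assumes "j < length xs"
  shows "sort xs ! j \<le> q \<longleftrightarrow> j < length (filter (\<lambda>x. x \<le> q) xs)"
  using sorted_nth_le_iff[of "sort xs" j q] assms by (simp add: filter_sort)

lemma sum_length_filter_eq:
  fixes as :: "nat list"
  assumes "0 \<notin> set as"
  shows "(\<Sum>p<q. length (filter (\<lambda>a. a = p + 1) as)) = length (filter (\<lambda>a. a \<le> q) as)"
proof (induction q)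
  case 0
  then show ?case using assms by (auto simp: filter_empty_conv intro: gr0I)
next
  case (Suc q)
  have "length (filter (\<lambda>a. a \<le> q) as) + length (filter (\<lambda>a. a = Suc q) as)
      = length (filter (\<lambda>a. a \<le> Suc q) as)"
    by (induction as) auto
  then show ?case using Suc by simp
qed

lemma parking_function_bound:
  assumes "parking_function d k as"
  shows "set as \<subseteq> {1..d * k + 1}"
proof
  fix a assume a: "a \<in> set as"
  then have "a \<in> set (sort as)" by simp
  then obtain j where j: "j < k" "a = sort as ! j"
    using assms unfolding parking_function_def by (metis in_set_conv_nth length_sort)
  then have "Suc j \<in> {1..k}" by simp
  then have "sort as ! j \<le> d * j + 1"
    using assms unfolding parking_function_def by fastforce
  also have "\<dots> \<le> d * k + 1" using j by simp
  finally show "a \<in> {1..d * k + 1}"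
    using a j assms unfolding parking_function_def by auto
qed

text \<open>With \<open>N q\<close> the number of entries at most \<open>q\<close>, the stack
  condition reads \<open>q < 1 + d * N q\<close>. At \<open>q = d * i + 1\<close> it says
  \<open>i < N q\<close>, which is the parking bound; since \<open>N\<close> is monotone, that bound
  covers all \<open>q\<close> from \<open>d * i + 1\<close> to \<open>d * i + d\<close>.\<close>

lemma lukasiewicz_parking_word:
  assumes d: "1 \<le> d" and len: "length as = k" and ran: "set as \<subseteq> {1..d * k + 1}"
  shows "lukasiewicz 1 (parking_word d k as) \<longleftrightarrow> parking_function d k as"
proof -
  let ?N = "\<lambda>q. length (filter (\<lambda>a. a \<le> q) as)"
  have sum: "(\<Sum>p<q. length (parking_word d k as ! p)) = d * ?N q" if "q \<le> d * k + 1" for q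
  proof -
    have "(\<Sum>p<q. length (parking_word d k as ! p)) = (\<Sum>p<q. d * length (filter (\<lambda>a. a = p + 1) as))"
      using that len by (intro sum.cong) (auto simp: parking_word_nth length_child_word)
    also have "\<dots> = d * ?N q"
      using ran by (subst sum_distrib_left[symmetric], subst sum_length_filter_eq) auto
    finally show ?thesis .
  qed
  \<comment> \<open>All \<open>k\<close> entries are counted at the end, so the letters have total
    length \<open>d * k\<close>: the final equation holds for every such \<open>as\<close>.\<close>
  have "filter (\<lambda>a. a \<le> d * k + 1) as = as"
    using ran by (auto simp: filter_id_conv)
  then have "1 + (\<Sum>p<d * k + 1. length (parking_word d k as ! p)) = d * k + 1"
    using sum[of "d * k + 1"] len by simp
  then have "lukasiewicz 1 (parking_word d k as) \<longleftrightarrow> (\<forall>q<d * k + 1. q < 1 + d * ?N q)"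
    unfolding lukasiewicz_def length_parking_word using sum by simp
  also have "\<dots> \<longleftrightarrow> (\<forall>i\<in>{1..k}. i - 1 < ?N (d * (i - 1) + 1))"
  proof (intro iffI ballI allI impI)
    fix i assume *: "\<forall>q<d * k + 1. q < 1 + d * ?N q" and i: "i \<in> {1..k}"
    have "d * Suc (i - 1) \<le> d * k"
      using i by (intro mult_le_mono2) auto
    then have "d * (i - 1) + d \<le> d * k" by simp
    then have "d * (i - 1) + 1 < d * k + 1" using d by linarith
    then have "d * (i - 1) < d * ?N (d * (i - 1) + 1)"
      using * by fastforce
    then show "i - 1 < ?N (d * (i - 1) + 1)" by simp
  next
    fix q assume *: "\<forall>i\<in>{1..k}. i - 1 < ?N (d * (i - 1) + 1)" and q: "q < d * k + 1"
    show "q < 1 + d * ?N q"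
    proof (cases "q = 0")
      case False
      \<comment> \<open>\<open>i\<close> is chosen so that \<open>q\<close> lies between
        \<open>d * i + 1\<close> and \<open>d * i + d\<close>; the \<open>q - 1\<close> is exact as
        \<open>q\<close> is nonzero.\<close>
      define i where "i = (q - 1) div d"
      have "d * i + (q - 1) mod d = q - 1" "(q - 1) mod d < d"
        using d by (simp_all add: i_def)
      then have i: "d * i + 1 \<le> q" "q \<le> d * Suc i"
        using False by auto
      have "i < k"
        using False q d by (auto simp: i_def less_mult_imp_div_less mult.commute)
      then have "Suc i \<le> ?N (d * i + 1)"
        using *[rule_format, of "Suc i"] by simp
      also have "\<dots> \<le> ?N q"
        using i(1) by (induction as) auto
      finally have "d * Suc i \<le> d * ?N q" by (rule mult_le_mono2)
      with i(2) show ?thesis by linarith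
    qed simp
  qed
  also have "\<dots> \<longleftrightarrow> (\<forall>i\<in>{1..k}. sort as ! (i - 1) \<le> d * (i - 1) + 1)"
    using len by (intro ball_cong refl sort_nth_le_iff[symmetric]) auto
  also have "\<dots> \<longleftrightarrow> parking_function d k as"
    using ran len by (auto simp: parking_function_def)
  finally show ?thesis .
qed

lemma parking_function_parking_vector:
  assumes d: "1 \<le> d" and T: "parking_tree d k T"
  shows "parking_function d k (parking_vector d k T)"
proof -
  have n: "card (vertices T) = d * k + 1"
    using T by (simp add: parking_tree_def)
  have "set (parking_vector d k T) \<subseteq> {1..d * k + 1}"
  proof
    fix a assume "a \<in> set (parking_vector d k T)"
    then have "a \<in> (\<lambda>i. dfs_order 1 T (common_parent d T i)) ` {1..k}"
      by (simp add: parking_vector_def atLeastLessThanSuc_atLeastAtMost del: upt_Suc)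
    then obtain i where i: "i \<in> {1..k}" "a = dfs_order 1 T (common_parent d T i)"
      by blast
    obtain v m where b: "is_block d T i v m"
      using T i(1) unfolding parking_tree_def by blast
    then have "v \<in> vertices T" by (simp add: is_block_def)
    then show "a \<in> {1..d * k + 1}"
      using dfs_order_bounds[of v T 1] n i(2) common_parent_eq[OF d T i(1) b] by auto
  qed
  moreover have "lukasiewicz 1 (parking_word d k (parking_vector d k T))"
    using lukasiewicz_forest[of "[T]"] preorder_parking_tree[OF d T] by simp
  ultimately show ?thesis
    using lukasiewicz_parking_word[OF d] length_parking_vector by blast
qed

section \<open>Bijectivity by way of preorder words\<close>

theorem theorem8p9:
  fixes d k :: nat
  assumes "1 \<le> d"
  shows "bij_betw (parking_vector d k) {T. parking_tree d k T} {as. parking_function d k as}"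
proof (rule bij_betw_imageI)
  show "inj_on (parking_vector d k) {T. parking_tree d k T}"
  proof (rule inj_onI)
    fix T U
    assume "T \<in> {T. parking_tree d k T}" "U \<in> {T. parking_tree d k T}"
    then have T: "parking_tree d k T" and U: "parking_tree d k U" by simp_all
    assume "parking_vector d k T = parking_vector d k U"
    then have "preorder T = preorder U"
      using preorder_parking_tree[OF assms] T U by simp
    moreover have "root_label T = root_label U"
      using T U by (simp add: parking_tree_def)
    ultimately show "T = U" by (rule tree_eqI)
  qed
  show "parking_vector d k ` {T. parking_tree d k T} = {as. parking_function d k as}"
  proof (intro equalityI subsetI)
    fix as assume "as \<in> {as. parking_function d k as}"
    then have as: "parking_function d k as" by simp
    then have len: "length as = k" by (simp add: parking_function_def)
    note ran = parking_function_bound[OF as]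
    \<comment> \<open>The stack initially holds only the root, labelled \<open>Infty\<close>, so the
      forest obtained consists of a single tree.\<close>
    have "lukasiewicz (length [Infty]) (parking_word d k as)"
      using lukasiewicz_parking_word[OF assms len ran] as by simp
    from forest_of_lukasiewicz[OF this] obtain ts
      where "map root_label ts = [Infty]" "concat (map preorder ts) = parking_word d k as"
      by (elim exE conjE)
    then obtain T where T: "root_label T = Infty" "preorder T = parking_word d k as"
      by (auto simp: map_eq_Cons_conv)
    show "as \<in> parking_vector d k ` {T. parking_tree d k T}"
      using parking_tree_of_word[OF assms T len ran] parking_vector_of_word[OF assms T len ran]
      by (intro image_eqI[of _ _ T]) auto
  qed (use parking_function_parking_vector[OF assms] in auto)
qed

end
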